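(* Let $Y$ be a Banach space and $A,B\in\mathscr{B}(Y)$. The operators $Q_{k,m}^{A,B}\in\mathscr{B}(Y)$, $k,m\in\mathbb{N}_0$, have the following properties: (i) (generalized Pascal rule) $Q_{k,m}^{A,B}=AQ_{k-1,m}^{A,B}+BQ_{k,m-1}^{A,B}$ for all $k,m\in\mathbb{N}$; (ii) if $AB=BA$, then $Q_{k,m}^{A,B}=\binom{k+m}{m}A^kB^m$ for all $k,m\in\mathbb{N}_0$.
   Context: $\mathscr{B}(Y)$ is the space of bounded linear operators on $Y$, $\mathbb{N}=\{1,2,\dots\}$, $\mathbb{N}_0=\mathbb{N}\cup\{0\}$. The operators $Q_{k,m}^{A,B}$ are defined by $Q_{k,0}^{A,B}=A^k$ for $k\in\mathbb{N}_0$, $Q_{0,m}^{A,B}=B^m$ for $m\in\mathbb{N}_0$, and $Q_{k,m}^{A,B}=\sum_{l=0}^{k}A^{k-l}BQ_{l,m-1}^{A,B}$ for $k,m\in\mathbb{N}$. *)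

theory Defs
  imports "HOL-Analysis.Analysis"
begin

text \<open>
  The space of bounded operators on \<open>Y\<close> is the library type \<open>'a \<Rightarrow>\<^sub>L 'a\<close>, with composition \<open>o\<^sub>L\<close>
  as product. It is not an instance of the type class for powers (only the diagonal
  types would be), so powers of operators are defined here, with \<open>A\<^sup>0\<close> the identity.
\<close>

primrec blinfun_pow :: "('a::real_normed_vector \<Rightarrow>\<^sub>L 'a) \<Rightarrow> nat \<Rightarrow> ('a \<Rightarrow>\<^sub>L 'a)" where
  "blinfun_pow A 0 = id_blinfun"
| "blinfun_pow A (Suc n) = A o\<^sub>L blinfun_pow A n"

text \<open>
  The first two clauses of the definition in the paper overlap at \<open>k = m = 0\<close>, where both
  give the identity; here that case is covered by the first equation.
\<close>

fun Q :: "('a::real_normed_vector \<Rightarrow>\<^sub>L 'a) \<Rightarrow> ('a \<Rightarrow>\<^sub>L 'a) \<Rightarrow> nat \<Rightarrow> nat \<Rightarrow> ('a \<Rightarrow>\<^sub>L 'a)" where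
  "Q A B k 0 = blinfun_pow A k"
| "Q A B 0 (Suc m) = blinfun_pow B (Suc m)"
| "Q A B (Suc k) (Suc m) =
     (\<Sum>l=0..Suc k. blinfun_pow A (Suc k - l) o\<^sub>L (B o\<^sub>L Q A B l m))"

lemma Q_0_left: "Q A B 0 m = blinfun_pow B m"
  by (cases m) simp_all

lemma Q_pos_pos:
  assumes "k \<ge> 1" "m \<ge> 1"
  shows "Q A B k m = (\<Sum>l=0..k. blinfun_pow A (k - l) o\<^sub>L (B o\<^sub>L Q A B l (m - 1)))"
proof -
  obtain k' m' where "k = Suc k'" "m = Suc m'"
    using assms by (metis One_nat_def Suc_le_D)
  then show ?thesis by (simp only: Q.simps diff_Suc_1)
qed

end

theory Submission
  imports Defs
begin

text \<open>
  The summation formula that defines \<open>Q A B k m\<close> for positive indices also holds for \<open>k = 0\<close>,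
  where its only term is \<open>B\<close> composed with a power of \<open>B\<close>. In the sum for \<open>k + 1\<close>, every term
  except the last carries a left factor \<open>A\<close>; pulling it out leaves exactly the sum for \<open>k\<close>, and
  the last term is \<open>B\<close> composed with \<open>Q A B (k + 1) (m - 1)\<close>. This is the Pascal rule, and the
  case \<open>k = 0\<close> of the formula is what makes it hold on the boundary \<open>k + 1 = 1\<close>.

  Read as words in \<open>A\<close> and \<open>B\<close>, \<open>Q A B k m\<close> is the sum of all words with \<open>k\<close> letters \<open>A\<close> and
  \<open>m\<close> letters \<open>B\<close>, and the Pascal rule sorts these words by their first letter. If \<open>A\<close> and \<open>B\<close>
  commute, all words agree, so only their number matters: the coefficients satisfy Pascal's
  recurrence with boundary values \<open>1\<close>, hence are the binomial coefficients.
\<close>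

lemma blinfun_compose_assoc: "(f o\<^sub>L g) o\<^sub>L h = f o\<^sub>L (g o\<^sub>L h)"
  by (rule blinfun_eqI) simp

lemma id_blinfun_compose [simp]: "id_blinfun o\<^sub>L f = f"
  by (rule blinfun_eqI) simp

lemma blinfun_compose_id [simp]: "f o\<^sub>L id_blinfun = f"
  by (rule blinfun_eqI) simp

lemma Q_Suc_right_sum:
  "Q A B k (Suc m) = (\<Sum>l\<le>k. blinfun_pow A (k - l) o\<^sub>L (B o\<^sub>L Q A B l m))"
  by (cases k) (simp_all add: Q_0_left atLeast0AtMost del: sum.atMost_Suc)

lemma Q_Pascal:
  "Q A B (Suc k) (Suc m) = (A o\<^sub>L Q A B k (Suc m)) + (B o\<^sub>L Q A B (Suc k) m)"
proof -
  let ?f = "\<lambda>l. B o\<^sub>L Q A B l m"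
  have "Q A B (Suc k) (Suc m) = (\<Sum>l\<le>k. blinfun_pow A (Suc k - l) o\<^sub>L ?f l) + ?f (Suc k)"
    unfolding Q_Suc_right_sum by simp
  also have "(\<Sum>l\<le>k. blinfun_pow A (Suc k - l) o\<^sub>L ?f l)
      = (\<Sum>l\<le>k. A o\<^sub>L (blinfun_pow A (k - l) o\<^sub>L ?f l))"
    by (intro sum.cong) (simp_all add: Suc_diff_le blinfun_compose_assoc)
  also have "\<dots> = A o\<^sub>L Q A B k (Suc m)"
    unfolding Q_Suc_right_sum
    by (rule bounded_bilinear.sum_right[OF bounded_bilinear_blinfun_compose, symmetric])
  finally show ?thesis .
qed

lemma blinfun_pow_commute:
  assumes "A o\<^sub>L B = B o\<^sub>L A"
  shows "B o\<^sub>L blinfun_pow A k = blinfun_pow A k o\<^sub>L B"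
proof (induction k)
  case (Suc k)
  have "B o\<^sub>L blinfun_pow A (Suc k) = A o\<^sub>L (B o\<^sub>L blinfun_pow A k)"
    using assms by (metis blinfun_compose_assoc blinfun_pow.simps(2))
  then show ?case
    by (simp add: Suc.IH blinfun_compose_assoc)
qed simp

text \<open>
  In the step of this nested induction the two summands of the Pascal rule are multiples of the
  same monomial: \<open>A\<close> joins the powers of \<open>A\<close> directly, whereas \<open>B\<close> has to be moved past them,
  which is the only place where commutation enters.
\<close>

lemma Q_commuting:
  assumes "A o\<^sub>L B = B o\<^sub>L A"
  shows "Q A B k m = real ((k + m) choose m) *\<^sub>R (blinfun_pow A k o\<^sub>L blinfun_pow B m)"
proof (induction m arbitrary: k)
  case 0
  show ?case by simp
next
  case outer: (Suc m)
  show ?case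
  proof (induction k)
    case 0
    show ?case by simp
  next
    case (Suc k)
    let ?M = "blinfun_pow A (Suc k) o\<^sub>L blinfun_pow B (Suc m)"
    have "A o\<^sub>L Q A B k (Suc m) = real ((k + Suc m) choose Suc m) *\<^sub>R ?M"
      by (simp add: Suc.IH bounded_bilinear.scaleR_right[OF bounded_bilinear_blinfun_compose]
          blinfun_compose_assoc del: binomial_Suc_Suc)
    moreover have "B o\<^sub>L Q A B (Suc k) m = real ((Suc k + m) choose m) *\<^sub>R ?M"
    proof -
      have "B o\<^sub>L (blinfun_pow A (Suc k) o\<^sub>L blinfun_pow B m) = ?M"
        using blinfun_pow_commute[OF assms, of "Suc k"]
        by (metis blinfun_compose_assoc blinfun_pow.simps(2))
      then show ?thesis
        by (simp add: outer.IH bounded_bilinear.scaleR_right[OF bounded_bilinear_blinfun_compose]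
            del: blinfun_pow.simps)
    qed
    ultimately have "Q A B (Suc k) (Suc m)
        = (real ((k + Suc m) choose Suc m) + real ((Suc k + m) choose m)) *\<^sub>R ?M"
      by (simp only: Q_Pascal scaleR_add_left)
    then show ?case
      by (simp add: add.commute del: blinfun_pow.simps Q.simps)
  qed
qed

theorem theorem3p3:
  fixes A B :: "'a::banach \<Rightarrow>\<^sub>L 'a"
  shows "(\<forall>k m. k \<ge> 1 \<longrightarrow> m \<ge> 1 \<longrightarrow>
            Q A B k m = (A o\<^sub>L Q A B (k - 1) m) + (B o\<^sub>L Q A B k (m - 1)))
       \<and> (A o\<^sub>L B = B o\<^sub>L A \<longrightarrow>
            (\<forall>k m. Q A B k m =
               real ((k + m) choose m) *\<^sub>R (blinfun_pow A k o\<^sub>L blinfun_pow B m)))"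
proof (intro conjI allI impI)
  fix k m :: nat
  assume "k \<ge> 1" "m \<ge> 1"
  then show "Q A B k m = (A o\<^sub>L Q A B (k - 1) m) + (B o\<^sub>L Q A B k (m - 1))"
    using Q_Pascal[of A B "k - 1" "m - 1"] by simp
qed (rule Q_commuting)

end
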